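(* Let $k\ge 1$ and $n\ge k+1$ be integers. If $G$ is an $\mathcal{F}_k$-saturated graph with $n$ vertices, then $$\lambda_1(G)\ge \frac{k-2+\sqrt{k^2+4k-4}}{2}.$$
   Context: All graphs are finite and simple (no loops or multiedges). For a positive integer $k$, $\mathcal{F}_k$ is the family of $k$-connected graphs; a $k$-connected graph is a graph with at least $k+1$ vertices that remains connected after deletion of any set of fewer than $k$ vertices. Given a family $\mathcal{F}$ of graphs, a graph $G$ is $\mathcal{F}$-saturated if (1) no subgraph of $G$ belongs to $\mathcal{F}$, and (2) for every edge $e$ of the complement $\overline{G}$, the graph $G+e$ contains a subgraph belonging to $\mathcal{F}$. The spectral radius $\lambda_1(G)$ is the largest eigenvalue of the adjacency matrix of $G$. *)

theory Defs
  imports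
    "Graph_Theory.Digraph_Component"
    "Jordan_Normal_Form.Spectral_Radius"
begin

text \<open>
  A finite simple graph is a \<^locale>\<open>pair_graph\<close>: finite vertex and arc sets, no loops, symmetric
  arc set (an edge \<open>uv\<close> is the pair of arcs \<open>(u, v)\<close>, \<open>(v, u)\<close>), and no parallel arcs since arcs
  are pairs.
\<close>

text \<open>Since every member is a \<^locale>\<open>pair_graph\<close>, a subgraph (in the digraph sense of
  \<^const>\<open>subgraph\<close>) that lies in this family is automatically an undirected subgraph.\<close>

definition k_connected_graphs :: "nat \<Rightarrow> 'a pair_pre_digraph set" where
  "k_connected_graphs k =
     {H. pair_graph H \<and> card (pverts H) \<ge> k + 1 \<and>
         (\<forall>S \<subseteq> pverts H. card S < k \<longrightarrow>
            Digraph_Component.connected (with_proj H \<restriction> (pverts H - S)))}"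

definition contains_member :: "'a pair_pre_digraph set \<Rightarrow> 'a pair_pre_digraph \<Rightarrow> bool" where
  "contains_member \<F> G \<longleftrightarrow> (\<exists>H \<in> \<F>. subgraph (with_proj H) (with_proj G))"

definition add_edge :: "'a pair_pre_digraph \<Rightarrow> 'a \<Rightarrow> 'a \<Rightarrow> 'a pair_pre_digraph" where
  "add_edge G u v = \<lparr>pverts = pverts G, parcs = parcs G \<union> {(u, v), (v, u)}\<rparr>"

definition saturated :: "'a pair_pre_digraph set \<Rightarrow> 'a pair_pre_digraph \<Rightarrow> bool" where
  "saturated \<F> G \<longleftrightarrow>
     \<not> contains_member \<F> G \<and>
     (\<forall>u \<in> pverts G. \<forall>v \<in> pverts G.
        u \<noteq> v \<and> (u, v) \<notin> parcs G \<longrightarrow> contains_member \<F> (add_edge G u v))"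

text \<open>The adjacency matrix with respect to an enumeration \<open>vs\<close> of the vertices.\<close>

definition adjacency_matrix :: "'a list \<Rightarrow> 'a pair_pre_digraph \<Rightarrow> real mat" where
  "adjacency_matrix vs G =
     mat (length vs) (length vs) (\<lambda>(i, j). if (vs ! i, vs ! j) \<in> parcs G then 1 else 0)"

text \<open>The largest eigenvalue does not depend on the chosen enumeration, see \<open>lambda1_eq\<close> below.\<close>

definition lambda1 :: "'a pair_pre_digraph \<Rightarrow> real" where
  "lambda1 G =
     Max (spectrum (adjacency_matrix (SOME vs. distinct vs \<and> set vs = pverts G) G))"

lemma eigenvalue_adjacency_matrix_iff:
  assumes vs: "distinct vs" "set vs = pverts G"
  shows "eigenvalue (adjacency_matrix vs G) c \<longleftrightarrow>
    (\<exists>x. (\<exists>v \<in> pverts G. x v \<noteq> 0) \<and>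
         (\<forall>v \<in> pverts G. (\<Sum>u \<in> pverts G. if (v, u) \<in> parcs G then x u else 0) = c * x v))"
    (is "?L \<longleftrightarrow> ?R")
proof -
  let ?n = "length vs" and ?A = "adjacency_matrix vs G"
  have dim: "dim_row ?A = ?n" "dim_col ?A = ?n"
    by (simp_all add: adjacency_matrix_def)
  have ix: "w \<in> pverts G \<longleftrightarrow> (\<exists>i < ?n. w = vs ! i)" for w
    unfolding vs(2)[symmetric] in_set_conv_nth by blast
  have all_ix: "(\<forall>w \<in> pverts G. P w) \<longleftrightarrow> (\<forall>i < ?n. P (vs ! i))" for P
    unfolding Ball_def ix by blast
  have bij: "bij_betw ((!) vs) {0..<?n} (pverts G)"
    by (rule bij_betw_nth) (simp_all add: vs atLeast0LessThan)
  have mult: "(?A *\<^sub>v vec ?n (\<lambda>i. x (vs ! i))) $ i =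
      (\<Sum>u \<in> pverts G. if (vs ! i, u) \<in> parcs G then x u else 0)" if "i < ?n" for x i
  proof -
    have "(?A *\<^sub>v vec ?n (\<lambda>i. x (vs ! i))) $ i =
        (\<Sum>j = 0..<?n. (\<lambda>u. if (vs ! i, u) \<in> parcs G then x u else 0) (vs ! j))"
      using that by (auto simp: adjacency_matrix_def scalar_prod_def intro!: sum.cong)
    then show ?thesis
      using sum.reindex_bij_betw[OF bij, of "\<lambda>u. if (vs ! i, u) \<in> parcs G then x u else 0"]
      by simp
  qed
  have key: "eigenvector ?A (vec ?n (\<lambda>i. x (vs ! i))) c \<longleftrightarrow>
      (\<exists>v \<in> pverts G. x v \<noteq> 0) \<and>
      (\<forall>v \<in> pverts G. (\<Sum>u \<in> pverts G. if (v, u) \<in> parcs G then x u else 0) = c * x v)" for x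
  proof -
    have "vec ?n (\<lambda>i. x (vs ! i)) \<noteq> 0\<^sub>v ?n \<longleftrightarrow> (\<exists>v \<in> pverts G. x v \<noteq> 0)"
      using all_ix[of "\<lambda>v. x v = 0"] by (auto simp add: vec_eq_iff)
    moreover have "?A *\<^sub>v vec ?n (\<lambda>i. x (vs ! i)) = c \<cdot>\<^sub>v vec ?n (\<lambda>i. x (vs ! i)) \<longleftrightarrow>
        (\<forall>i < ?n. (?A *\<^sub>v vec ?n (\<lambda>i. x (vs ! i))) $ i = c * x (vs ! i))"
      by (simp add: vec_eq_iff dim del: index_mult_mat_vec)
    moreover have "\<dots> \<longleftrightarrow> (\<forall>v \<in> pverts G.
        (\<Sum>u \<in> pverts G. if (v, u) \<in> parcs G then x u else 0) = c * x v)"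
      unfolding all_ix by (simp only: mult cong: imp_cong)
    ultimately show ?thesis
      unfolding eigenvector_def dim by simp
  qed
  show ?thesis
  proof
    assume ?L
    then obtain w where w: "eigenvector ?A w c"
      by (auto simp: eigenvalue_def)
    then have wc: "w \<in> carrier_vec ?n"
      unfolding eigenvector_def dim by blast
    define x where "x u = w $ (the_inv_into {0..<?n} ((!) vs) u)" for u
    have w_eq: "w = vec ?n (\<lambda>i. x (vs ! i))"
    proof (rule eq_vecI)
      show "w $ i = vec ?n (\<lambda>i. x (vs ! i)) $ i" if "i < dim_vec (vec ?n (\<lambda>i. x (vs ! i)))" for i
        using that the_inv_into_f_f[OF bij_betw_imp_inj_on[OF bij], of i] by (simp add: x_def)
      show "dim_vec w = dim_vec (vec ?n (\<lambda>i. x (vs ! i)))"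
        using carrier_vecD[OF wc] by simp
    qed
    have "eigenvector ?A (vec ?n (\<lambda>i. x (vs ! i))) c"
      using w by (subst w_eq[symmetric])
    then show ?R unfolding key by (rule exI[of _ x])
  next
    assume ?R
    then show ?L unfolding eigenvalue_def key[symmetric] by blast
  qed
qed

lemma lambda1_eq:
  assumes "distinct vs" "set vs = pverts G"
  shows "lambda1 G = Max (spectrum (adjacency_matrix vs G))"
proof -
  let ?ws = "SOME vs. distinct vs \<and> set vs = pverts G"
  have "distinct ?ws \<and> set ?ws = pverts G"
    by (rule someI[of _ vs]) (simp add: assms)
  then have ws: "distinct ?ws" "set ?ws = pverts G" by blast+
  have "eigenvalue (adjacency_matrix ?ws G) c \<longleftrightarrow> eigenvalue (adjacency_matrix vs G) c" for c
    unfolding eigenvalue_adjacency_matrix_iff[OF ws] eigenvalue_adjacency_matrix_iff[OF assms] ..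
  then have "spectrum (adjacency_matrix ?ws G) = spectrum (adjacency_matrix vs G)"
    by (auto simp: spectrum_def)
  then show ?thesis by (simp add: lambda1_def)
qed

end

theory Submission
  imports Defs
begin

text \<open>
  A saturated graph \<open>G\<close> is not complete, because a complete graph on at least \<open>k + 1\<close> vertices is
  itself \<open>k\<close>-connected. Hence \<open>G\<close> has a non-edge \<open>uv\<close>, and \<open>G + uv\<close> contains a \<open>k\<close>-connected graph
  \<open>H\<close>. All degrees in \<open>H\<close> are at least \<open>k\<close>, so deleting \<open>uv\<close> from \<open>H\<close> leaves a subgraph of \<open>G\<close> in
  which every vertex has degree at least \<open>k\<close>, except that \<open>u\<close> and \<open>v\<close> may only have degree \<open>k - 1\<close>.

  The number \<open>\<rho>\<close> on the right-hand side is the spectral radius of \<open>K\<^sub>k\<^sub>+\<^sub>1\<close> minus an edge, and the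
  proof reuses the eigenvector of that graph. Put the weight \<open>b\<close> on \<open>u\<close> and \<open>v\<close>, \<open>1\<close> on the other
  vertices of \<open>H\<close>, and \<open>0\<close> outside \<open>H\<close>. For \<open>K\<^sub>k\<^sub>+\<^sub>1\<close> minus an edge the eigenvalue equations read
  \<open>\<rho> b = k - 1\<close> at the ends of the missing edge and \<open>\<rho> = k - 2 + 2 b\<close> elsewhere; the second one
  fixes \<open>b\<close>, the first one then holds as well, and \<open>0 < b \<le> 1\<close>. In \<open>G\<close> the degree bounds turn the
  two equations into inequalities: the weights \<open>x\<close> satisfy \<open>A x \<ge> \<rho> x\<close> for the
  adjacency matrix \<open>A\<close> (lemma \<open>le_lambda1_if_contains_k_connected_minus_edge\<close>). As \<open>x \<ge> 0\<close>, its
  Rayleigh quotient is at least \<open>\<rho>\<close>.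

  That a real symmetric matrix has a real eigenvalue at least as large as any of its Rayleigh
  quotients is \<open>eigenvalue_ge_rayleigh_quotient\<close>. Its proof avoids compactness: the least upper
  bound \<open>\<mu>\<close> of the Rayleigh quotients must be an eigenvalue, since otherwise the inverse of
  \<open>A - \<mu> I\<close> could be used to lower the bound (lemma \<open>form_upper_bound_improves\<close>).
\<close>

section \<open>Rayleigh quotients and eigenvalues of real symmetric matrices\<close>

lemma quadratic_form_bounded:
  fixes A :: "real mat"
  assumes A: "A \<in> carrier_mat n n"
  obtains c where "c > 0" "\<And>x. x \<in> carrier_vec n \<Longrightarrow> \<bar>x \<bullet> (A *\<^sub>v x)\<bar> \<le> c * (x \<bullet> x)"
proof
  let ?c = "1 + (\<Sum>i<n. \<Sum>j<n. \<bar>A $$ (i, j)\<bar>)"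
  show "?c > 0"
    by (simp add: add_pos_nonneg sum_nonneg)
  fix x :: "real vec" assume x: "x \<in> carrier_vec n"
  then have xx: "x \<bullet> x = (\<Sum>i<n. (x $ i)\<^sup>2)"
    by (simp add: scalar_prod_def power2_eq_square atLeast0LessThan)
  have coord: "(x $ i)\<^sup>2 \<le> x \<bullet> x" if "i < n" for i
    unfolding xx using that by (intro member_le_sum) auto
  have prod: "\<bar>x $ i * x $ j\<bar> \<le> x \<bullet> x" if "i < n" "j < n" for i j
  proof -
    have "0 \<le> (\<bar>x $ i\<bar> - \<bar>x $ j\<bar>)\<^sup>2" by simp
    then have "2 * \<bar>x $ i * x $ j\<bar> \<le> (x $ i)\<^sup>2 + (x $ j)\<^sup>2"
      by (simp add: power2_diff abs_mult)
    then show ?thesis using coord[OF that(1)] coord[OF that(2)] by linarith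
  qed
  have "x \<bullet> (A *\<^sub>v x) = (\<Sum>i<n. \<Sum>j<n. A $$ (i, j) * (x $ i * x $ j))"
    using A x by (simp add: scalar_prod_def atLeast0LessThan sum_distrib_left mult_ac)
  then have "\<bar>x \<bullet> (A *\<^sub>v x)\<bar> \<le> (\<Sum>i<n. \<bar>\<Sum>j<n. A $$ (i, j) * (x $ i * x $ j)\<bar>)"
    by simp
  also have "\<dots> \<le> (\<Sum>i<n. \<Sum>j<n. \<bar>A $$ (i, j) * (x $ i * x $ j)\<bar>)"
    by (intro sum_mono sum_abs)
  also have "\<dots> \<le> (\<Sum>i<n. \<Sum>j<n. \<bar>A $$ (i, j)\<bar> * (x \<bullet> x))"
    using prod by (intro sum_mono) (auto simp: abs_mult[of "A $$ _"] intro!: mult_left_mono)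
  also have "\<dots> = (\<Sum>i<n. \<Sum>j<n. \<bar>A $$ (i, j)\<bar>) * (x \<bullet> x)"
    by (simp add: sum_distrib_right)
  also have "\<dots> \<le> ?c * (x \<bullet> x)"
    unfolding xx by (intro mult_right_mono) (auto intro: sum_nonneg)
  finally show "\<bar>x \<bullet> (A *\<^sub>v x)\<bar> \<le> ?c * (x \<bullet> x)" .
qed

text \<open>
  If \<open>\<mu>\<close> is not an eigenvalue, every \<open>x\<close> is \<open>(A - \<mu> I) y\<close> for some \<open>y\<close> depending linearly on \<open>x\<close>. For
  small \<open>s > 0\<close>, the upper bound at \<open>x + s y\<close> is stronger than the one at \<open>x\<close>: the cross term
  contributes \<open>-2 s (x \<bullet> x)\<close>, while the second order term is only \<open>s\<^sup>2\<close> times \<open>- (x \<bullet> y)\<close>, which is a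
  quadratic form in \<open>x\<close> and thus at most \<open>c (x \<bullet> x)\<close>. The choice \<open>s = 1 / c\<close> leaves a gain of \<open>1 / c\<close>.
\<close>

lemma form_upper_bound_improves:
  fixes A :: "real mat"
  assumes A: "A \<in> carrier_mat n n" and sym: "transpose_mat A = A"
    and upper: "\<And>x. x \<in> carrier_vec n \<Longrightarrow> x \<bullet> (A *\<^sub>v x) \<le> \<mu> * (x \<bullet> x)"
    and not_ev: "\<not> eigenvalue A \<mu>"
  shows "\<exists>\<epsilon> > 0. \<forall>x \<in> carrier_vec n. x \<bullet> (A *\<^sub>v x) \<le> (\<mu> - \<epsilon>) * (x \<bullet> x)"
proof -
  let ?D = "char_matrix A \<mu>"
  have D: "?D \<in> carrier_mat n n" using A by simp
  have "det ?D \<noteq> 0" using not_ev eigenvalue_det[OF A] by simp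
  from det_non_zero_imp_unit[OF D this, where b = "()"]
  obtain C where C: "C \<in> carrier_mat n n" and DC: "?D * C = 1\<^sub>m n"
    unfolding Units_def ring_mat_def by auto
  obtain c where c: "c > 0" and bound: "\<And>x. x \<in> carrier_vec n \<Longrightarrow> \<bar>x \<bullet> (C *\<^sub>v x)\<bar> \<le> c * (x \<bullet> x)"
    using quadratic_form_bounded[OF C] by blast
  show ?thesis
  proof (intro exI[of _ "1 / c"] conjI ballI)
    show "1 / c > 0" using c by simp
    fix x :: "real vec" assume x: "x \<in> carrier_vec n"
    define y where "y = C *\<^sub>v x"
    have y: "y \<in> carrier_vec n" using C x by (simp add: y_def)
    have "?D *\<^sub>v y = x"
      unfolding y_def using assoc_mult_mat_vec[OF D C x] DC x by simp
    moreover have "?D *\<^sub>v y = A *\<^sub>v y + (- \<mu>) \<cdot>\<^sub>v y"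
      unfolding char_matrix_def
      by (rule eq_vecI) (use A y in \<open>auto simp: add_scalar_prod_distrib[of _ n]\<close>)
    ultimately have Ay: "A *\<^sub>v y = x + \<mu> \<cdot>\<^sub>v y"
      using A x y by (auto simp: vec_eq_iff algebra_simps)
    define s where "s = 1 / c"
    let ?z = "x + s \<cdot>\<^sub>v y"
    have Ax: "A *\<^sub>v x \<in> carrier_vec n" using A x by simp
    have yAx: "y \<bullet> (A *\<^sub>v x) = x \<bullet> x + \<mu> * (x \<bullet> y)"
    proof -
      have "y \<bullet> (A *\<^sub>v x) = (A *\<^sub>v y) \<bullet> x"
        using transpose_vec_mult_scalar[OF A x y] sym by simp
      then show ?thesis
        unfolding Ay using x y
        by (simp add: add_scalar_prod_distrib[of _ n] comm_scalar_prod[of y n x])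
    qed
    have Az: "A *\<^sub>v ?z = A *\<^sub>v x + s \<cdot>\<^sub>v (x + \<mu> \<cdot>\<^sub>v y)"
      using A x y by (simp add: mult_add_distrib_mat_vec[of _ n n] mult_mat_vec[of _ n n] Ay)
    have "?z \<bullet> (A *\<^sub>v ?z) \<le> \<mu> * (?z \<bullet> ?z)"
      using x y by (intro upper) simp
    moreover have "?z \<bullet> ?z = x \<bullet> x + 2 * s * (x \<bullet> y) + s\<^sup>2 * (y \<bullet> y)"
      using x y by (simp add: add_scalar_prod_distrib[of _ n] scalar_prod_add_distrib[of _ n]
          comm_scalar_prod[of y n x] power2_eq_square algebra_simps)
    moreover have "?z \<bullet> (A *\<^sub>v ?z) = x \<bullet> (A *\<^sub>v x) + 2 * s * (x \<bullet> x) + 2 * s * \<mu> * (x \<bullet> y)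
        + s\<^sup>2 * (x \<bullet> y) + s\<^sup>2 * \<mu> * (y \<bullet> y)"
      unfolding Az using x y Ax
      by (simp add: add_scalar_prod_distrib[of _ n] scalar_prod_add_distrib[of _ n]
          comm_scalar_prod[of y n x] yAx power2_eq_square algebra_simps)
    ultimately have "x \<bullet> (A *\<^sub>v x) \<le> \<mu> * (x \<bullet> x) - 2 * s * (x \<bullet> x) - s\<^sup>2 * (x \<bullet> y)"
      by (simp add: algebra_simps)
    also have "- s\<^sup>2 * (x \<bullet> y) \<le> s\<^sup>2 * (c * (x \<bullet> x))"
    proof -
      have "- (x \<bullet> y) \<le> c * (x \<bullet> x)" using bound[OF x] by (simp add: y_def abs_le_iff)
      from mult_left_mono[OF this, of "s\<^sup>2"] show ?thesis by simp
    qed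
    then have "\<mu> * (x \<bullet> x) - 2 * s * (x \<bullet> x) - s\<^sup>2 * (x \<bullet> y) \<le> (\<mu> - s) * (x \<bullet> x)"
      using c by (simp add: s_def power2_eq_square algebra_simps)
    finally show "x \<bullet> (A *\<^sub>v x) \<le> (\<mu> - 1 / c) * (x \<bullet> x)"
      by (simp add: s_def)
  qed
qed

text \<open>
  The upper bounds \<open>t\<close> with \<open>z \<bullet> A z \<le> t (z \<bullet> z)\<close> for all \<open>z\<close> have a least element, and by the
  preceding lemma the least one is an eigenvalue.
\<close>

lemma eigenvalue_ge_rayleigh_quotient:
  fixes A :: "real mat"
  assumes A: "A \<in> carrier_mat n n" and sym: "transpose_mat A = A"
    and x: "x \<in> carrier_vec n" and pos: "x \<bullet> x > 0"
    and rayleigh: "r * (x \<bullet> x) \<le> x \<bullet> (A *\<^sub>v x)"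
  obtains \<mu> where "eigenvalue A \<mu>" "r \<le> \<mu>"
proof -
  define S where "S = {t. \<forall>z \<in> carrier_vec n. z \<bullet> (A *\<^sub>v z) \<le> t * (z \<bullet> z)}"
  obtain c where "\<And>z. z \<in> carrier_vec n \<Longrightarrow> \<bar>z \<bullet> (A *\<^sub>v z)\<bar> \<le> c * (z \<bullet> z)"
    using quadratic_form_bounded[OF A] by blast
  then have "c \<in> S" by (fastforce simp: S_def abs_le_iff)
  have lower: "r \<le> t" if "t \<in> S" for t
  proof -
    have "r * (x \<bullet> x) \<le> t * (x \<bullet> x)"
      using rayleigh that x by (fastforce simp: S_def)
    then show ?thesis using pos by simp
  qed
  then have bdd: "bdd_below S" by (meson bdd_belowI)
  have Inf_in: "z \<bullet> (A *\<^sub>v z) \<le> Inf S * (z \<bullet> z)" if z: "z \<in> carrier_vec n" for z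
  proof (cases "z \<bullet> z > 0")
    case True
    have "(z \<bullet> (A *\<^sub>v z)) / (z \<bullet> z) \<le> Inf S"
      using \<open>c \<in> S\<close> True z by (intro cInf_greatest) (auto simp: S_def field_simps)
    then show ?thesis using True by (simp add: field_simps)
  next
    case False
    moreover have "z \<bullet> z \<ge> 0" by (simp add: scalar_prod_def sum_nonneg)
    ultimately have "z \<bullet> z = 0" by simp
    then show ?thesis using \<open>c \<in> S\<close> z by (force simp: S_def)
  qed
  have "eigenvalue A (Inf S)"
  proof (rule ccontr)
    assume not_ev: "\<not> ?thesis"
    obtain \<epsilon> where "\<epsilon> > 0"
      and "\<forall>z \<in> carrier_vec n. z \<bullet> (A *\<^sub>v z) \<le> (Inf S - \<epsilon>) * (z \<bullet> z)"
      using form_upper_bound_improves[OF A sym Inf_in not_ev] by auto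
    then have "\<epsilon> > 0" "Inf S - \<epsilon> \<in> S" by (simp_all add: S_def)
    then show False using cInf_lower[OF _ bdd, of "Inf S - \<epsilon>"] by simp
  qed
  moreover have "r \<le> Inf S" using \<open>c \<in> S\<close> lower by (intro cInf_greatest) auto
  ultimately show ?thesis by (rule that)
qed

section \<open>Lower bounds on the largest adjacency eigenvalue\<close>

text \<open>
  The inequality is only required on the support of \<open>x\<close>: the vector enters through its Rayleigh
  quotient, in which row \<open>v\<close> is weighted by \<open>x v\<close>. So \<open>x\<close> can be supported on a subgraph.
\<close>

lemma le_lambda1_if_subeigenvector:
  assumes G: "pair_graph G"
    and nonneg: "\<And>v. v \<in> pverts G \<Longrightarrow> x v \<ge> 0"
    and nonzero: "\<exists>v \<in> pverts G. x v \<noteq> 0"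
    and sub: "\<And>v. v \<in> pverts G \<Longrightarrow> x v \<noteq> 0 \<Longrightarrow>
      r * x v \<le> (\<Sum>u \<in> pverts G. if (v, u) \<in> parcs G then x u else 0)"
  shows "r \<le> lambda1 G"
proof -
  interpret pair_graph G by (rule G)
  obtain vs where vs: "distinct vs" "set vs = pverts G"
    using finite_distinct_list[OF pair_finite_verts] by blast
  let ?n = "length vs" and ?A = "adjacency_matrix vs G"
  let ?x = "vec ?n (\<lambda>i. x (vs ! i))"
  have A: "?A \<in> carrier_mat ?n ?n" by (simp add: adjacency_matrix_def)
  have "(u, v) \<in> parcs G \<longleftrightarrow> (v, u) \<in> parcs G" for u v
    using pair_sym_arcs by (auto simp: symmetric_def sym_def)
  then have sym: "transpose_mat ?A = ?A"
    by (auto simp: adjacency_matrix_def intro!: eq_matI)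
  have bij: "bij_betw ((!) vs) {0..<?n} (pverts G)"
    by (rule bij_betw_nth) (simp_all add: vs atLeast0LessThan)
  note reindex = sum.reindex_bij_betw[OF bij]
  let ?N = "\<lambda>v. \<Sum>u \<in> pverts G. if (v, u) \<in> parcs G then x u else 0"
  have xx: "?x \<bullet> ?x = (\<Sum>v \<in> pverts G. (x v)\<^sup>2)"
    by (simp add: scalar_prod_def power2_eq_square flip: reindex)
  have Ax: "(?A *\<^sub>v ?x) $ i = ?N (vs ! i)" if "i < ?n" for i
    using that by (auto simp: adjacency_matrix_def scalar_prod_def simp flip: reindex intro!: sum.cong)
  have xAx: "?x \<bullet> (?A *\<^sub>v ?x) = (\<Sum>v \<in> pverts G. x v * ?N v)"
  proof -
    have "?x \<bullet> (?A *\<^sub>v ?x) = (\<Sum>i = 0..<?n. (\<lambda>v. x v * ?N v) (vs ! i))"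
      using A unfolding scalar_prod_def by (intro sum.cong) (auto simp: Ax simp del: index_mult_mat_vec)
    also have "\<dots> = (\<Sum>v \<in> pverts G. x v * ?N v)" by (rule reindex)
    finally show ?thesis .
  qed
  have "?x \<bullet> ?x > 0"
    unfolding xx using nonzero pair_finite_verts by (auto intro: sum_pos2)
  moreover have "r * (?x \<bullet> ?x) \<le> ?x \<bullet> (?A *\<^sub>v ?x)"
  proof -
    have "r * (x v)\<^sup>2 \<le> x v * ?N v" if v: "v \<in> pverts G" for v
    proof (cases "x v = 0")
      case False
      from mult_left_mono[OF sub[OF v False] nonneg[OF v]]
      show ?thesis by (simp add: power2_eq_square mult_ac)
    qed simp
    then show ?thesis unfolding xx xAx sum_distrib_left by (rule sum_mono)
  qed
  ultimately obtain \<mu> where "eigenvalue ?A \<mu>" "r \<le> \<mu>"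
    using eigenvalue_ge_rayleigh_quotient[OF A sym, of ?x r] by auto
  moreover have "\<mu> \<le> Max (spectrum ?A)" if "eigenvalue ?A \<mu>" for \<mu>
    using that card_finite_spectrum(1)[OF A] by (simp add: spectrum_def)
  ultimately show ?thesis unfolding lambda1_eq[OF vs] by force
qed

section \<open>Vertex connectivity\<close>

text \<open>
  If \<open>w\<close> had fewer than \<open>k\<close> neighbours, deleting all of them would disconnect \<open>w\<close> from the other
  remaining vertices, and there is at least one because \<open>H\<close> has at least \<open>k + 1\<close> vertices.
\<close>

lemma k_connected_min_degree:
  assumes H: "H \<in> k_connected_graphs k" and w: "w \<in> pverts H"
  shows "card {z. (w, z) \<in> parcs H} \<ge> k"
proof (rule ccontr)
  let ?N = "{z. (w, z) \<in> parcs H}"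
  assume less: "\<not> k \<le> card ?N"
  interpret pair_graph H using H by (simp add: k_connected_graphs_def)
  have N: "?N \<subseteq> pverts H" using wellformed' by auto
  have fin: "finite ?N" by (rule finite_subset[OF N pair_finite_verts])
  have wN: "w \<notin> ?N" using pair_no_loops by force
  have sym: "(a, b) \<in> parcs H \<longleftrightarrow> (b, a) \<in> parcs H" for a b
    using pair_sym_arcs by (auto simp: symmetric_def sym_def)
  have "card (insert w ?N) < card (pverts H)"
    using H less wN fin by (simp add: k_connected_graphs_def)
  then obtain z where z: "z \<in> pverts H" "z \<noteq> w" "z \<notin> ?N"
    using fin by (metis card_mono finite_insert insertCI not_le subsetI)
  let ?K = "mk_symmetric (with_proj H \<restriction> (pverts H - ?N))"
  have "Digraph_Component.connected (with_proj H \<restriction> (pverts H - ?N))"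
    using H N less by (simp add: k_connected_graphs_def)
  then have "w \<rightarrow>\<^sup>*\<^bsub>with_proj ?K\<^esub> z"
    using w wN z by (simp add: Digraph_Component.connected_def strongly_connected_def)
  then have "(w, z) \<in> (parcs ?K)\<^sup>*"
    unfolding reachable_def by (auto dest: rtrancl_on_rtranclI)
  then obtain y where "(w, y) \<in> parcs ?K"
    using z by (metis converse_rtranclE)
  then have "(w, y) \<in> parcs H" "y \<notin> ?N"
    using sym by (auto simp: parcs_mk_symmetric)
  then show False by simp
qed

lemma complete_graph_k_connected:
  assumes G: "pair_graph G" and card: "card (pverts G) \<ge> k + 1"
    and complete: "\<And>u v. u \<in> pverts G \<Longrightarrow> v \<in> pverts G \<Longrightarrow> u \<noteq> v \<Longrightarrow> (u, v) \<in> parcs G"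
  shows "G \<in> k_connected_graphs k"
proof -
  interpret pair_graph G by (rule G)
  have "Digraph_Component.connected (with_proj G \<restriction> (pverts G - S))"
    if S: "S \<subseteq> pverts G" "card S < k" for S
  proof -
    let ?K = "mk_symmetric (with_proj G \<restriction> (pverts G - S))"
    have ne: "pverts G - S \<noteq> {}"
      using S card card_mono[of S "pverts G"] finite_subset[OF S(1) pair_finite_verts] by force
    have "u \<rightarrow>\<^sup>*\<^bsub>with_proj ?K\<^esub> v" if uv: "u \<in> pverts G - S" "v \<in> pverts G - S" for u v
    proof (cases "u = v")
      case True
      then show ?thesis using uv by (auto simp: reachable_def)
    next
      case False
      then have "(u, v) \<in> parcs ?K"
        using uv complete by (force simp: parcs_mk_symmetric)
      then show ?thesis
        using uv unfolding reachable_def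
        by (auto intro: converse_rtrancl_on_into_rtrancl_on)
    qed
    then show ?thesis
      using ne by (simp add: Digraph_Component.connected_def strongly_connected_def)
  qed
  then show ?thesis using G card by (simp add: k_connected_graphs_def)
qed

section \<open>Saturated graphs\<close>

lemma saturated_imp_contains_k_connected_minus_edge:
  assumes G: "pair_graph G" and card: "card (pverts G) \<ge> k + 1"
    and sat: "saturated (k_connected_graphs k) G"
  obtains u v H where "u \<noteq> v" "H \<in> k_connected_graphs k" "pverts H \<subseteq> pverts G"
    "parcs H \<subseteq> parcs G \<union> {(u, v), (v, u)}"
proof -
  interpret pair_graph G by (rule G)
  have "subgraph (with_proj G) (with_proj G)"
    by (simp add: subgraph_def compatible_def wf_digraph_axioms)
  then have "G \<notin> k_connected_graphs k"
    using sat by (auto simp: saturated_def contains_member_def)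
  then obtain u v where "u \<in> pverts G" "v \<in> pverts G" "u \<noteq> v" "(u, v) \<notin> parcs G"
    using complete_graph_k_connected[OF G card] by blast
  moreover from this obtain H where
    "H \<in> k_connected_graphs k" "subgraph (with_proj H) (with_proj (add_edge G u v))"
    using sat unfolding saturated_def contains_member_def by blast
  ultimately show ?thesis
    by (intro that[of u v H]) (auto simp: subgraph_def add_edge_def)
qed

text \<open>
  The weights are \<open>b\<close> on \<open>u\<close> and \<open>v\<close>, \<open>1\<close> elsewhere on \<open>H\<close>, and \<open>0\<close> outside \<open>H\<close>. A vertex among
  \<open>u\<close>, \<open>v\<close> loses at most one neighbour when \<open>uv\<close> is deleted, and its remaining neighbours in \<open>H\<close>
  all have weight \<open>1\<close>. Any other vertex keeps its at least \<open>k\<close> neighbours, of which at most two have weight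
  \<open>b\<close> instead of \<open>1\<close>. So the neighbour sums are at least \<open>k - 1\<close> and \<open>k - 2 (1 - b)\<close>, respectively.
\<close>

lemma le_lambda1_if_contains_k_connected_minus_edge:
  fixes b r :: real
  assumes G: "pair_graph G" and k: "k \<ge> 1"
    and H: "H \<in> k_connected_graphs k" and "pverts H \<subseteq> pverts G"
    and arcs: "parcs H \<subseteq> parcs G \<union> {(u, v), (v, u)}" and "u \<noteq> v"
    and b: "0 < b" "b \<le> 1" "r * b \<le> real k - 1" "r \<le> real k - 2 + 2 * b"
  shows "r \<le> lambda1 G"
proof (rule le_lambda1_if_subeigenvector[OF G])
  interpret H: pair_graph H using H by (simp add: k_connected_graphs_def)
  interpret G: pair_graph G by (rule G)
  define x where "x w = (if w \<in> pverts H then if w = u \<or> w = v then b else 1 else 0)" for w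
  show "x w \<ge> 0" for w using b by (simp add: x_def)
  have "pverts H \<noteq> {}" using H by (auto simp: k_connected_graphs_def)
  then show "\<exists>w \<in> pverts G. x w \<noteq> 0"
    using b \<open>pverts H \<subseteq> pverts G\<close> by (auto simp: x_def)
  fix w assume "w \<in> pverts G" "x w \<noteq> 0"
  then have w: "w \<in> pverts H" by (simp add: x_def split: if_splits)
  let ?N = "{z. (w, z) \<in> parcs H}"
  let ?S = "\<Sum>z \<in> pverts G. if (w, z) \<in> parcs G then x z else 0"
  have N: "?N \<subseteq> pverts H" using H.wellformed' by auto
  have fin: "finite ?N" by (rule finite_subset[OF N H.pair_finite_verts])
  have deg: "k \<le> card ?N" by (rule k_connected_min_degree[OF H w])
  have S_ge: "(\<Sum>z \<in> M. x z) \<le> ?S" if "M \<subseteq> ?N" "\<And>z. z \<in> M \<Longrightarrow> (w, z) \<in> parcs G" for M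
  proof -
    have "(\<Sum>z \<in> M. x z) = (\<Sum>z \<in> M. if (w, z) \<in> parcs G then x z else 0)"
      using that by (intro sum.cong) auto
    also have "\<dots> \<le> ?S"
      using that N \<open>pverts H \<subseteq> pverts G\<close> b
      by (intro sum_mono2 G.pair_finite_verts) (auto simp: x_def)
    finally show ?thesis .
  qed
  show "r * x w \<le> ?S"
  proof (cases "w = u \<or> w = v")
    case True
    define M where "M = ?N - {u, v}"
    \<comment> \<open>By looplessness only the other one of \<open>u\<close> and \<open>v\<close> is removed.\<close>
    have "M = ?N - {if w = u then v else u}"
      using True H.pair_no_loops[of "(w, w)"] by (auto simp: M_def)
    then have "k \<le> card M + 1"
      using deg diff_card_le_card_Diff[of "{if w = u then v else u}" ?N] by simp
    then have "real k - 1 \<le> real (card M)" by linarith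
    also have "\<dots> = (\<Sum>z \<in> M. x z)"
      using N by (subst sum.cong[of M M x "\<lambda>_. 1"]) (auto simp: M_def x_def)
    also have "\<dots> \<le> ?S"
      using arcs by (intro S_ge) (auto simp: M_def)
    finally show ?thesis using True w b(3) by (simp add: x_def)
  next
    case False
    have "real k - 2 * (1 - b) \<le> real (card ?N) - (1 - b) * real (card (?N \<inter> {u, v}))"
    proof -
      have "card (?N \<inter> {u, v}) \<le> card {u, v}" by (intro card_mono) auto
      also have "\<dots> \<le> 2" by (simp add: card_insert_if)
      finally have "(1 - b) * real (card (?N \<inter> {u, v})) \<le> (1 - b) * 2"
        using b by (intro mult_left_mono) auto
      then show ?thesis using deg by linarith
    qed
    also have "\<dots> = (\<Sum>z \<in> ?N. 1 - (1 - b) * (if z \<in> {u, v} then 1 else 0))"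
      using fin by (simp add: sum_subtractf sum.If_cases Int_def flip: sum_distrib_left)
    also have "\<dots> = (\<Sum>z \<in> ?N. x z)"
      using N by (intro sum.cong) (auto simp: x_def)
    also have "\<dots> \<le> ?S"
      using arcs False by (intro S_ge) auto
    finally show ?thesis using False w b(4) by (simp add: x_def)
  qed
qed

theorem theorem4p5:
  fixes G :: "'a pair_pre_digraph" and k n :: nat
  assumes "k \<ge> 1" and "n \<ge> k + 1"
    and "pair_graph G" and "card (pverts G) = n"
    and "saturated (k_connected_graphs k) G"
  shows "lambda1 G \<ge> (real k - 2 + sqrt ((real k)\<^sup>2 + 4 * real k - 4)) / 2"
proof -
  define s where "s = sqrt ((real k)\<^sup>2 + 4 * real k - 4)"
  \<comment> \<open>The solution of \<open>\<rho> = k - 2 + 2 b\<close>; that \<open>\<rho> b = k - 1\<close> holds too is the quadratic equation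
      \<open>\<rho>\<^sup>2 = (k - 2) \<rho> + 2 (k - 1)\<close>.\<close>
  define b where "b = (s - real k + 2) / 4"
  have k: "real k \<ge> 1" using assms(1) by simp
  have s2: "s\<^sup>2 = (real k)\<^sup>2 + 4 * real k - 4"
    unfolding s_def using k one_le_power[OF k, of 2] by (intro real_sqrt_pow2) linarith
  have "real k - 1 \<le> s"
    unfolding s_def using k by (intro real_le_rsqrt) (simp add: power2_diff)
  then have "0 < b" by (simp add: b_def)
  moreover have "s \<le> real k + 2"
    unfolding s_def using k by (intro real_le_lsqrt) (auto simp: power2_sum)
  then have "b \<le> 1" by (simp add: b_def)
  moreover have "(real k - 2 + s) / 2 * b \<le> real k - 1"
    using s2 by (simp add: b_def field_simps power2_eq_square)
  moreover have "(real k - 2 + s) / 2 \<le> real k - 2 + 2 * b"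
    by (simp add: b_def field_simps)
  moreover obtain u v H where "u \<noteq> v" "H \<in> k_connected_graphs k" "pverts H \<subseteq> pverts G"
    "parcs H \<subseteq> parcs G \<union> {(u, v), (v, u)}"
    using saturated_imp_contains_k_connected_minus_edge[OF assms(3) _ assms(5)] assms by metis
  ultimately have "(real k - 2 + s) / 2 \<le> lambda1 G"
    by (intro le_lambda1_if_contains_k_connected_minus_edge[OF assms(3,1), of H u v b])
  then show ?thesis by (simp only: s_def)
qed

end
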